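(* Let $G$ be a finite Abelian group. Then $\operatorname{rank}(G)+2$ uniformly random (independently chosen) elements of $G$ generate $G$ with probability at least $1/2$.
   Context: $\operatorname{rank}(G)$ is the minimal cardinality of a generating set of $G$ (so the trivial group has rank $0$). Elements are sampled uniformly and independently with replacement. *)

theory Defs
  imports "HOL-Algebra.Generated_Groups" "HOL-Probability.Probability_Mass_Function"
begin

text \<open>
  The rank of a group that is not finitely generated is unspecified. Finiteness of \<open>S\<close> is required
  because \<^const>\<open>card\<close> maps infinite sets to \<open>0\<close>.
\<close>
definition group_rank :: "('a, 'b) monoid_scheme \<Rightarrow> nat" where
  "group_rank G =
     (LEAST n. \<exists>S. S \<subseteq> carrier G \<and> finite S \<and> card S = n \<and> generate G S = carrier G)"

end

theory Submission
  imports Defs "HOL-Algebra.Elementary_Groups" "HOL-Algebra.Multiplicative_Group"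
begin

text \<open>
  If a list does not generate \<open>G\<close>, then it lies in the kernel of an epimorphism from \<open>G\<close> onto
  \<open>\<int>/p\<close> for some prime \<open>p\<close>. There are at most \<open>p ^ r\<close> of these when \<open>r\<close> is the rank, and each kernel
  contains \<open>r + 2\<close> random elements with probability \<open>1 / p ^ (r + 2)\<close>. By the union bound the
  probability of failure is at most the sum of \<open>1 / p\<^sup>2\<close> over the primes. This sum is at most \<open>1/2\<close>:
  the prime \<open>2\<close> contributes \<open>1/4\<close>, and the squares of the odd numbers \<open>2 * j + 1\<close> contribute at most
  \<open>1/4\<close> by comparison with the telescoping series of \<open>1 / (4 * j * (j + 1))\<close>.
\<close>

section \<open>Independent samples from a fixed distribution\<close>

lemma prob_replicate_pmf_subset:
  "measure_pmf.prob (replicate_pmf n p) {xs. set xs \<subseteq> B} = measure_pmf.prob p B ^ n"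
proof (induction n)
  case 0
  then show ?case by (simp add: measure_return_pmf)
next
  case (Suc n)
  let ?X = "{xs. set xs \<subseteq> B}" and ?R = "measure_pmf (replicate_pmf n p)"
  have "replicate_pmf (Suc n) p = p \<bind> (\<lambda>x. map_pmf (Cons x) (replicate_pmf n p))"
    by (simp add: map_pmf_def)
  then have "emeasure (replicate_pmf (Suc n) p) ?X = (\<integral>\<^sup>+x. emeasure ?R (Cons x -` ?X) \<partial>p)"
    by (simp add: emeasure_bind_pmf)
  \<comment> \<open>The preimage of the event under \<open>Cons x\<close> is the event itself if
    \<open>x \<in> B\<close> and empty otherwise.\<close>
  also have "\<dots> = (\<integral>\<^sup>+x. emeasure ?R ?X * indicator B x \<partial>p)"
    by (intro nn_integral_cong) (auto simp: vimage_def split: split_indicator)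
  also have "\<dots> = emeasure ?R ?X * emeasure p B"
    by (simp add: nn_integral_cmult)
  finally show ?case
    using Suc by (simp add: measure_def enn2real_mult)
qed

section \<open>Inverse squares of the primes\<close>

lemma sum_inverse_odd_squares_le:
  "(\<Sum>j=1..n. 1 / (2 * real j + 1)\<^sup>2) \<le> 1 / 4 - 1 / (4 * (real n + 1))"
proof (induction n)
  case 0
  then show ?case by simp
next
  case (Suc n)
  \<comment> \<open>With j = n + 1, the square (2j + 1)^2 exceeds 4j(j + 1) by 1. The term 1 / (4(n
    + 1)) subtracted in the claim is the tail of the telescoping series; this stronger bound is what
    lets the induction close.\<close>
  have "1 / (2 * real (Suc n) + 1)\<^sup>2 \<le> 1 / (4 * ((real n + 1) * (real n + 2)))"
    by (rule divide_left_mono) (simp_all add: power2_eq_square algebra_simps add_pos_nonneg)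
  also have "\<dots> = 1 / (4 * (real n + 1)) - 1 / (4 * (real n + 2))"
    by (simp add: divide_simps, simp add: algebra_simps)
  finally have "1 / (2 * real (Suc n) + 1)\<^sup>2 \<le> 1 / (4 * (real n + 1)) - 1 / (4 * (real n + 2))" .
  with Suc show ?case by (simp add: algebra_simps)
qed

lemma sum_inverse_prime_squares_le:
  assumes "finite P" and "\<And>p. p \<in> P \<Longrightarrow> prime (p::nat)"
  shows "(\<Sum>p\<in>P. 1 / (real p)\<^sup>2) \<le> 1 / 2"
proof -
  \<comment> \<open>Any upper bound of \<open>P\<close> would do; inserting 0 gives
    \<open>Max\<close> a meaning when \<open>P\<close> is empty.\<close>
  define n where "n = Max (insert 0 P)"
  have "P \<subseteq> insert 2 ((\<lambda>j. 2 * j + 1) ` {1..n})"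
  proof
    fix p assume p: "p \<in> P"
    have "p \<le> n" unfolding n_def using assms p by simp
    show "p \<in> insert 2 ((\<lambda>j. 2 * j + 1) ` {1..n})"
    proof (cases "p = 2")
      case False
      have "p > 1" using assms(2)[OF p] by (rule prime_gt_1_nat)
      have "odd p" using False assms(2)[OF p] by (metis primes_dvd_imp_eq two_is_prime_nat)
      then obtain j where "p = 2 * j + 1" by (elim oddE)
      with \<open>p \<le> n\<close> \<open>p > 1\<close> show ?thesis by auto
    qed simp
  qed
  then have "(\<Sum>p\<in>P. 1 / (real p)\<^sup>2)
      \<le> (\<Sum>p\<in>insert 2 ((\<lambda>j. 2 * j + 1) ` {1..n}). 1 / (real p)\<^sup>2)"
    by (intro sum_mono2) auto
  also have "\<dots> = 1 / 4 + (\<Sum>p\<in>(\<lambda>j. 2 * j + 1) ` {1..n}. 1 / (real p)\<^sup>2)"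
  proof (subst sum.insert)
    show "2 \<notin> (\<lambda>j. 2 * j + 1) ` {1..n}" by (auto; presburger)
  qed auto
  also have "(\<Sum>p\<in>(\<lambda>j. 2 * j + 1) ` {1..n}. 1 / (real p)\<^sup>2) = (\<Sum>j=1..n. 1 / (2 * real j + 1)\<^sup>2)"
    by (subst sum.reindex) (auto simp: inj_on_def add.commute)
  also have "\<dots> \<le> 1 / 4"
    using sum_inverse_odd_squares_le[of n] by (smt (verit) divide_nonneg_nonneg of_nat_0_le_iff)
  finally show ?thesis by simp
qed

section \<open>Counting epimorphisms onto cyclic groups and their kernels\<close>

text \<open>Membership in \<open>epi\<close> constrains a function only on the carrier. Adding
  \<open>extensional\<close> fixes the values elsewhere, so that each epimorphism is counted once.
  Surjectivity gives the kernel index exactly \<open>p\<close>.\<close>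

definition cyclic_characters :: "('a, 'b) monoid_scheme \<Rightarrow> nat \<Rightarrow> ('a \<Rightarrow> int) set" where
  "cyclic_characters G p = epi G (integer_mod_group p) \<inter> extensional (carrier G)"

lemma (in group) hom_eq_on_generate:
  assumes "f \<in> hom G H" "h \<in> hom G H" "group H" "S \<subseteq> carrier G"
    and eq: "\<And>s. s \<in> S \<Longrightarrow> f s = h s" and "x \<in> generate G S"
  shows "f x = h x"
proof -
  interpret f: group_hom G H f using assms by (simp add: group_hom_def group_hom_axioms_def)
  interpret h: group_hom G H h using assms by (simp add: group_hom_def group_hom_axioms_def)
  show ?thesis
    using assms(6)
  proof induction
    case (eng a b)
    then show ?case using generate_in_carrier[OF \<open>S \<subseteq> carrier G\<close>] by simp
  qed (use \<open>S \<subseteq> carrier G\<close> eq in auto)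
qed

text \<open>A homomorphism is determined by its values on a generating set, so restriction to
  \<open>S\<close> embeds the characters into the functions from \<open>S\<close> to a set of
  \<open>p\<close> elements.\<close>

lemma (in group) card_cyclic_characters_le:
  assumes S: "S \<subseteq> carrier G" "finite S" "generate G S = carrier G" and "p > 0"
  shows "finite (cyclic_characters G p)" "card (cyclic_characters G p) \<le> p ^ card S"
proof -
  have inj: "inj_on (\<lambda>\<psi>. restrict \<psi> S) (cyclic_characters G p)"
  proof
    fix f h assume *: "f \<in> cyclic_characters G p" "h \<in> cyclic_characters G p"
      "restrict f S = restrict h S"
    then have hom: "f \<in> hom G (integer_mod_group p)" "h \<in> hom G (integer_mod_group p)"
      by (simp_all add: cyclic_characters_def epi_def)
    show "f = h"
    proof (rule extensionalityI)
      fix x assume "x \<in> carrier G"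
      moreover have "f s = h s" if "s \<in> S" for s
        using *(3) that by (metis restrict_apply')
      ultimately show "f x = h x"
        using hom_eq_on_generate[OF hom group_integer_mod_group S(1)] S(3) by blast
    qed (use * in \<open>auto simp: cyclic_characters_def\<close>)
  qed
  have sub: "(\<lambda>\<psi>. restrict \<psi> S) ` cyclic_characters G p \<subseteq> S \<rightarrow>\<^sub>E {0..<int p}"
  proof (rule image_subsetI)
    fix \<psi> assume "\<psi> \<in> cyclic_characters G p"
    \<comment> \<open>Positivity of \<open>p\<close> matters: \<open>integer_mod_group 0\<close> is
      the infinite group of all integers.\<close>
    then have "\<psi> ` carrier G = {0..<int p}"
      using \<open>p > 0\<close> by (simp add: cyclic_characters_def epi_def carrier_integer_mod_group)
    then have "\<psi> s \<in> {0..<int p}" if "s \<in> S" for s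
      using S(1) that by blast
    then show "restrict \<psi> S \<in> S \<rightarrow>\<^sub>E {0..<int p}" by (simp add: PiE_iff)
  qed
  have fin: "finite (S \<rightarrow>\<^sub>E {0..<int p})" using S by (simp add: finite_PiE)
  show "finite (cyclic_characters G p)"
    using inj_on_finite[OF inj sub fin] .
  show "card (cyclic_characters G p) \<le> p ^ card S"
    using card_inj_on_le[OF inj sub fin] S by (simp add: card_PiE)
qed

text \<open>By the first isomorphism theorem the cosets of the kernel correspond to the
  \<open>p\<close> residues; Lagrange's theorem then gives the product.\<close>

lemma (in group) card_kernel_cyclic_character:
  assumes "\<psi> \<in> cyclic_characters G p" and "p > 0"
  shows "card (kernel G (integer_mod_group p) \<psi>) * p = card (carrier G)"
proof -
  interpret \<psi>: group_hom G "integer_mod_group p" \<psi>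
    using assms by (simp add: group_hom_def group_hom_axioms_def cyclic_characters_def epi_def)
  let ?K = "kernel G (integer_mod_group p) \<psi>"
  have "(\<lambda>X. the_elem (\<psi> ` X)) \<in> iso (G Mod ?K) (integer_mod_group p)"
    using assms by (intro \<psi>.FactGroup_iso_set) (simp add: cyclic_characters_def epi_def)
  then have "card (rcosets ?K) = p"
    using \<open>p > 0\<close> bij_betw_same_card
    by (fastforce simp: iso_def FactGroup_def carrier_integer_mod_group)
  then show ?thesis
    using lagrange[OF \<psi>.subgroup_kernel] by (simp add: Coset.order_def mult.commute)
qed

section \<open>Quotients of prime order\<close>

lemma (in group) iso_integer_mod_group_ord:
  assumes a: "a \<in> carrier G" and "ord a > 0" and gen: "generate G {a} = carrier G"
  shows "(\<lambda>k. a [^] (k::int)) \<in> iso (integer_mod_group (ord a)) G"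
proof -
  let ?Z = "integer_mod_group (ord a)"
  \<comment> \<open>This equivalence serves three times: reducing exponents preserves the power
    (homomorphism), distinct residues give distinct powers (injectivity), and every power has a
    reduced exponent (surjectivity).\<close>
  have eq: "a [^] k = a [^] l \<longleftrightarrow> k mod int (ord a) = l mod int (ord a)" for k l :: int
  proof -
    have "a [^] k = a [^] l \<longleftrightarrow> a [^] (k - l) = \<one>"
      using a by (metis int_pow_closed int_pow_diff inv_closed inv_equality inv_inv r_inv)
    then show ?thesis using a by (simp add: int_pow_eq_id mod_eq_dvd_iff)
  qed
  have "(\<lambda>k. a [^] k) \<in> hom ?Z G"
  proof (rule homI)
    fix x y assume "x \<in> carrier ?Z" "y \<in> carrier ?Z"
    have "a [^] ((x + y) mod int (ord a)) = a [^] (x + y)" by (simp add: eq)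
    then show "a [^] (x \<otimes>\<^bsub>?Z\<^esub> y) = a [^] x \<otimes> a [^] y"
      using a by (simp add: int_pow_mult)
  qed (use a in auto)
  moreover have "inj_on (\<lambda>k. a [^] k) (carrier ?Z)"
    using \<open>ord a > 0\<close> by (auto simp: inj_on_def eq carrier_integer_mod_group)
  moreover have "(\<lambda>k. a [^] k) ` carrier ?Z = carrier G"
  proof -
    have "x \<in> (\<lambda>k. a [^] k) ` carrier ?Z" if "x \<in> carrier G" for x
    proof -
      obtain k :: int where "x = a [^] k"
        using gen \<open>x \<in> carrier G\<close> generate_pow[OF a] by auto
      then have "x = a [^] (k mod int (ord a))" by (simp add: eq)
      then show ?thesis using \<open>ord a > 0\<close> by (auto simp: carrier_integer_mod_group)
    qed
    then show ?thesis using a by auto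
  qed
  ultimately show ?thesis by (simp add: iso_def bij_betw_def)
qed

text \<open>Some power of a nontrivial element has prime order. By \<open>gen\<close> that power
  generates the whole group, which is therefore cyclic of prime order.\<close>

lemma (in group) ex_iso_integer_mod_group_prime:
  assumes "finite (carrier G)" and "carrier G \<noteq> {\<one>}"
    and gen: "\<And>a. a \<in> carrier G \<Longrightarrow> a \<noteq> \<one> \<Longrightarrow> generate G {a} = carrier G"
  shows "\<exists>p f. prime p \<and> p \<le> card (carrier G) \<and> f \<in> iso G (integer_mod_group p)"
proof -
  obtain a where a: "a \<in> carrier G" "a \<noteq> \<one>" using assms(2) one_closed by blast
  have ord0: "ord x > 0" if "x \<in> carrier G" for x using ord_ge_1[OF assms(1) that] by simp
  have "ord a \<noteq> 1" using a by (metis nat_pow_eone pow_ord_eq_1)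
  then obtain p where p: "prime p" "p dvd ord a" using prime_factor_nat by blast
  then obtain m where m: "ord a = p * m" by blast
  have m0: "m > 0" using m ord0[OF a(1)] by (metis gr0I mult_is_0)
  define b where "b = a [^] m"
  have b: "b \<in> carrier G" using a b_def by simp
  have ob: "ord b = p" unfolding b_def using a m m0 p
    by (simp add: ord_pow_gen prime_gt_0_nat)
  then have "b \<noteq> \<one>" using p ob by (metis ord_eq_1 not_prime_1 b)
  then have gb: "generate G {b} = carrier G" using gen b by blast
  have iso: "(\<lambda>k. b [^] (k::int)) \<in> iso (integer_mod_group p) G"
    using iso_integer_mod_group_ord[OF b ord0[OF b] gb] ob by simp
  have "p \<le> card (carrier G)" using generate_pow_card[OF b] gb ob by simp
  with p iso group.iso_set_sym[OF _ iso] show ?thesis by auto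
qed

text \<open>
  The character factors through the quotient by a maximal subgroup containing \<open>H\<close>, in which every
  nontrivial element is a generator.
\<close>

lemma (in comm_group) ex_cyclic_character:
  assumes fin: "finite (carrier G)" and H: "subgroup H G" "H \<noteq> carrier G"
  obtains p \<psi> where "prime p" "p \<le> card (carrier G)" "\<psi> \<in> cyclic_characters G p"
    "H \<subseteq> kernel G (integer_mod_group p) \<psi>"
proof -
  define A where "A = {M. subgroup M G \<and> M \<noteq> carrier G}"
  have "finite A"
    by (rule finite_subset[of _ "Pow (carrier G)"]) (use fin in \<open>auto simp: A_def dest: subgroup.subset\<close>)
  then obtain M where M: "M \<in> A" "H \<subseteq> M" and max: "\<And>N. N \<in> A \<Longrightarrow> M \<subseteq> N \<Longrightarrow> N = M"
    using finite_has_maximal2[of A H] H by (auto simp: A_def)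
  have sM: "subgroup M G" and MG: "M \<noteq> carrier G" using M by (auto simp: A_def)
  have nM: "M \<lhd> G" using sM by (simp add: subgroup_imp_normal)
  interpret M: normal M G by fact
  let ?Q = "G Mod M"
  interpret Q: group ?Q by (rule M.factorgroup_is_group)
  interpret q: group_hom G ?Q "\<lambda>x. M #> x"
    by (simp add: group_hom_def group_hom_axioms_def M.r_coset_hom_Mod Q.group_axioms group_axioms)
  have surj: "(\<lambda>x. M #> x) ` carrier G = carrier ?Q"
    by (auto simp: FactGroup_def RCOSETS_def)
  have ker: "M #> x = \<one>\<^bsub>?Q\<^esub> \<longleftrightarrow> x \<in> M" if "x \<in> carrier G" for x
    using that sM by (metis FactGroup_def M.is_subgroup coset_join1 coset_join2 monoid.simps(2) M.subset)
  have gen: "generate ?Q {a} = carrier ?Q" if a: "a \<in> carrier ?Q" "a \<noteq> \<one>\<^bsub>?Q\<^esub>" for a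
  proof -
    obtain x where x: "x \<in> carrier G" "a = M #> x" using a surj by auto
    \<comment> \<open>The preimage of \<open>generate ?Q {a}\<close> in \<open>G\<close> is a
      subgroup containing \<open>M\<close> and also \<open>x\<close>, which lies outside
      \<open>M\<close>. Maximality of \<open>M\<close> forces it to be all of
      \<open>G\<close>.\<close>
    define N where "N = {y \<in> carrier G. M #> y \<in> generate ?Q {a}}"
    have sg: "subgroup (generate ?Q {a}) ?Q" using a by (intro Q.generate_is_subgroup) auto
    have "subgroup N G"
    proof (rule subgroupI)
      have "\<one> \<in> N" using subgroup.one_closed[OF sg] q.hom_one by (simp add: N_def)
      then show "N \<noteq> {}" by blast
      show "inv y \<in> N" if "y \<in> N" for y
        using that subgroup.m_inv_closed[OF sg] q.hom_inv[of y] by (simp add: N_def)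
      show "y \<otimes> z \<in> N" if "y \<in> N" "z \<in> N" for y z
        using that subgroup.m_closed[OF sg] q.hom_mult[of y z] by (simp add: N_def)
    qed (auto simp: N_def)
    moreover have "M \<subseteq> N"
    proof
      fix y assume "y \<in> M"
      then have "y \<in> carrier G" "M #> y = \<one>\<^bsub>?Q\<^esub>" using M.subset ker by blast+
      then show "y \<in> N" by (simp only: N_def generate.one mem_Collect_eq simp_thms)
    qed
    moreover have "x \<in> N" using x by (auto simp: N_def intro: generate.incl)
    moreover have "x \<notin> M" using x a ker by auto
    ultimately have "N = carrier G" using max[of N] by (auto simp: A_def)
    then have "M #> y \<in> generate ?Q {a}" if "y \<in> carrier G" for y
      using that unfolding N_def by blast
    then have "carrier ?Q \<subseteq> generate ?Q {a}"
      unfolding surj[symmetric] by (rule image_subsetI)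
    then show ?thesis using subgroup.subset[OF sg] by (simp only: subset_antisym)
  qed
  have "finite (carrier ?Q)" using fin surj by (metis finite_imageI)
  moreover have "carrier ?Q \<noteq> {\<one>\<^bsub>?Q\<^esub>}"
  proof
    assume *: "carrier ?Q = {\<one>\<^bsub>?Q\<^esub>}"
    have "x \<in> M" if "x \<in> carrier G" for x using ker[OF that] q.hom_closed[OF that] * by auto
    then show False using MG M.subset by auto
  qed
  ultimately obtain p f where p: "prime p" "p \<le> card (carrier ?Q)" and f: "f \<in> iso ?Q (integer_mod_group p)"
    using Q.ex_iso_integer_mod_group_prime gen by blast
  \<comment> \<open>The quotient map followed by \<open>f\<close>, restricted so that it is
    extensional as \<open>cyclic_characters\<close> demands.\<close>
  define \<psi> where "\<psi> = restrict (\<lambda>x. f (M #> x)) (carrier G)"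
  have "\<psi> \<in> hom G (integer_mod_group p)"
    using f unfolding iso_def hom_def \<psi>_def by (auto simp: Pi_iff)
  moreover have "\<psi> ` carrier G = carrier (integer_mod_group p)"
  proof -
    have "\<psi> ` carrier G = f ` (\<lambda>x. M #> x) ` carrier G" by (auto simp: \<psi>_def)
    then show ?thesis using f surj by (simp add: iso_def bij_betw_def)
  qed
  ultimately have "\<psi> \<in> cyclic_characters G p"
    by (simp add: cyclic_characters_def epi_def \<psi>_def)
  moreover have "H \<subseteq> kernel G (integer_mod_group p) \<psi>"
  proof
    fix x assume "x \<in> H"
    then have x: "x \<in> M" "x \<in> carrier G" using M(2) M.subset by auto
    then have "\<psi> x = f \<one>\<^bsub>?Q\<^esub>" by (simp add: \<psi>_def flip: ker)
    also have "\<dots> = \<one>\<^bsub>integer_mod_group p\<^esub>"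
      using f by (intro hom_one) (auto simp: iso_def Q.group_axioms)
    finally show "x \<in> kernel G (integer_mod_group p) \<psi>" using x by (simp add: kernel_def)
  qed
  moreover have "p \<le> card (carrier G)"
    using p(2) card_image_le[OF fin, of "\<lambda>x. M #> x"] surj by simp
  ultimately show ?thesis using that p by blast
qed

section \<open>The rank and the union bound\<close>

lemma ex_generators_card_group_rank:
  assumes "group G" and "finite (carrier G)"
  shows "\<exists>S. S \<subseteq> carrier G \<and> finite S \<and> card S = group_rank G \<and> generate G S = carrier G"
proof -
  interpret group G by fact
  \<comment> \<open>The carrier is itself a finite generating set, so the \<open>LEAST\<close> in
    \<open>group_rank\<close> is attained.\<close>
  have "generate G (carrier G) = carrier G"
    by (meson equalityI generate.incl generate_incl order_refl subsetI)
  then show ?thesis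
    unfolding group_rank_def using assms(2)
    by (intro LeastI_ex[of "\<lambda>n. \<exists>S. S \<subseteq> carrier G \<and> finite S \<and> card S = n \<and> generate G S = carrier G"])
      blast
qed

theorem theorem6:
  fixes G :: "('a, 'b) monoid_scheme"
  assumes "comm_group G" and "finite (carrier G)"
  shows "measure_pmf.prob (replicate_pmf (group_rank G + 2) (pmf_of_set (carrier G)))
           {xs. generate G (set xs) = carrier G} \<ge> 1 / 2"
proof -
  interpret comm_group G by fact
  define r where "r = group_rank G"
  define D where "D = replicate_pmf (r + 2) (pmf_of_set (carrier G))"
  \<comment> \<open>The size bound makes the union finite and loses nothing, since
    \<open>ex_cyclic_character\<close> supplies a prime in this range.\<close>
  define P where "P = {p. prime p \<and> p \<le> card (carrier G)}"
  define K where "K = (\<lambda>p. kernel G (integer_mod_group p))"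
  obtain S where S: "S \<subseteq> carrier G" "finite S" "card S = r" "generate G S = carrier G"
    using ex_generators_card_group_rank[OF is_group assms(2)] by (auto simp: r_def)
  have finP: "finite P" unfolding P_def by (rule finite_subset[of _ "{..card (carrier G)}"]) auto
  have P0: "p > 0" if "p \<in> P" for p using that by (simp add: P_def prime_gt_0_nat)
  have ne: "carrier G \<noteq> {}" by blast
  have finC: "finite (cyclic_characters G p)" if "p \<in> P" for p
    using card_cyclic_characters_le(1)[OF S(1,2,4) P0[OF that]] .
  have prob: "measure_pmf.prob D {xs. set xs \<subseteq> K p \<psi>} = (1 / real p) ^ (r + 2)"
    if "p \<in> P" "\<psi> \<in> cyclic_characters G p" for p \<psi>
  proof -
    have "carrier G \<inter> K p \<psi> = K p \<psi>" by (auto simp: K_def kernel_def)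
    moreover have "real (card (K p \<psi>)) * real p = real (card (carrier G))"
      using card_kernel_cyclic_character[OF that(2) P0[OF that(1)]] by (metis K_def of_nat_mult)
    moreover have "card (carrier G) > 0" using assms(2) ne by (simp add: card_gt_0_iff)
    ultimately have "measure_pmf.prob (pmf_of_set (carrier G)) (K p \<psi>) = 1 / real p"
      using measure_pmf_of_set[OF ne assms(2), of "K p \<psi>"] P0[OF that(1)]
      by (simp add: frac_eq_eq)
    then show ?thesis by (simp only: D_def prob_replicate_pmf_subset)
  qed
  let ?F = "\<lambda>p \<psi>. {xs. set xs \<subseteq> K p \<psi>}"
  \<comment> \<open>The inclusion of events is shown only for lists in the support of
    \<open>D\<close>, whose entries lie in \<open>carrier G\<close>; hence monotonicity is applied
    almost everywhere.\<close>
  have "measure_pmf.prob D (- {xs. generate G (set xs) = carrier G})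
      \<le> measure_pmf.prob D (\<Union>p\<in>P. \<Union>\<psi>\<in>cyclic_characters G p. ?F p \<psi>)"
  proof (rule measure_pmf.finite_measure_mono_AE)
    have "xs \<in> (\<Union>p\<in>P. \<Union>\<psi>\<in>cyclic_characters G p. ?F p \<psi>)"
      if xs: "xs \<in> set_pmf D" "generate G (set xs) \<noteq> carrier G" for xs
    proof -
      have sub: "set xs \<subseteq> carrier G"
        using xs(1) assms(2) ne by (auto simp: D_def set_replicate_pmf simp del: replicate_pmf.simps)
      obtain p \<psi> where "prime p" "p \<le> card (carrier G)" "\<psi> \<in> cyclic_characters G p"
        "generate G (set xs) \<subseteq> kernel G (integer_mod_group p) \<psi>"
        using ex_cyclic_character[OF assms(2) generate_is_subgroup[OF sub] xs(2)] .
      moreover have "set xs \<subseteq> generate G (set xs)" by (auto intro: generate.incl)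
      ultimately show ?thesis by (auto simp: P_def K_def)
    qed
    then show "AE xs in D. xs \<in> - {xs. generate G (set xs) = carrier G} \<longrightarrow>
        xs \<in> (\<Union>p\<in>P. \<Union>\<psi>\<in>cyclic_characters G p. ?F p \<psi>)"
      by (auto simp: AE_measure_pmf_iff)
  qed simp
  also have "\<dots> \<le> (\<Sum>p\<in>P. measure_pmf.prob D (\<Union>\<psi>\<in>cyclic_characters G p. ?F p \<psi>))"
    using finP by (intro measure_pmf.finite_measure_subadditive_finite) auto
  also have "\<dots> \<le> (\<Sum>p\<in>P. \<Sum>\<psi>\<in>cyclic_characters G p. measure_pmf.prob D (?F p \<psi>))"
    using finC by (intro sum_mono measure_pmf.finite_measure_subadditive_finite) auto
  also have "\<dots> \<le> (\<Sum>p\<in>P. 1 / (real p)\<^sup>2)"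
  proof (rule sum_mono)
    fix p assume p: "p \<in> P"
    have "(\<Sum>\<psi>\<in>cyclic_characters G p. measure_pmf.prob D (?F p \<psi>))
        = real (card (cyclic_characters G p)) * (1 / real p) ^ (r + 2)"
      using prob[OF p] by simp
    \<comment> \<open>The factor \<open>p ^ r\<close> from counting characters cancels
      \<open>r\<close> of the \<open>r + 2\<close> samples; the two extra samples leave the summable
      1 / p^2.\<close>
    also have "\<dots> \<le> real p ^ r * (1 / real p) ^ (r + 2)"
      using card_cyclic_characters_le(2)[OF S(1,2,4) P0[OF p]] S(3)
      by (intro mult_right_mono) (auto simp flip: of_nat_power)
    also have "\<dots> = 1 / (real p)\<^sup>2"
      using P0[OF p] by (simp add: power_add power_divide power2_eq_square)
    finally show "(\<Sum>\<psi>\<in>cyclic_characters G p. measure_pmf.prob D (?F p \<psi>)) \<le> 1 / (real p)\<^sup>2" .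
  qed
  also have "\<dots> \<le> 1 / 2"
    using finP by (intro sum_inverse_prime_squares_le) (auto simp: P_def)
  finally have "measure_pmf.prob D (- {xs. generate G (set xs) = carrier G}) \<le> 1 / 2" .
  then have "measure_pmf.prob D {xs. generate G (set xs) = carrier G} \<ge> 1 / 2"
    using measure_pmf.prob_compl[of "{xs. generate G (set xs) = carrier G}" D]
    by (simp add: Compl_eq_Diff_UNIV)
  then show ?thesis by (simp only: D_def r_def)
qed

end
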